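(* The Optimized Gradient Method with Memory, run with an input $L\ge L_f$, has the worst-case rate $$f(x_k)-f(x^* )\le\frac{L\|x_0-x^*\|^2}{k(k+1)},\qquad x^*\in X^*,\quad k\ge1 .$$
   Context: $\mathbb{E}$ is an $n$-dimensional real vector space, $\mathbb{E}^*$ its dual, $\langle s,x\rangle$ the value of $s\in\mathbb{E}^*$ at $x\in\mathbb{E}$ (and $\langle\cdot,\cdot\rangle$ the standard inner product on Euclidean coordinate spaces). $B:\mathbb{E}\to\mathbb{E}^*$ is a symmetric positive definite linear operator, $\|x\|=\sqrt{\langle Bx,x\rangle}$ and $\|g\|_*=\sqrt{\langle g,B^{-1}g\rangle}$. $f:\mathbb{E}\to\mathbb{R}$ is convex and differentiable, with gradient Lipschitz continuous with constant $L_f>0$. The set $X^*$ of minimizers of $f$ is non-empty. $\Delta_m$ is the standard simplex in $\mathbb{R}^m$. Optimized Gradient Method with Memory. Input: $x_0\in\mathbb{E}$, $L\ge L_f$. Set $v_0=x_0$, $A_0=0$, $\tau=1/L$. For $k=0,1,2,\dots$: 1. $a_{k+1}=\frac{\tau}{2}\left(1+\sqrt{1+8LA_k}\right)$, the positive root of $La_{k+1}^2=2A_k+a_{k+1}$. 2. $y_{k+1}=\frac{1}{A_k+a_{k+1}}(A_kx_k+a_{k+1}v_k)$, $\bar g_{k+1}=\nabla f(y_{k+1})$, $x_{k+1}=y_{k+1}-\tau B^{-1}\bar g_{k+1}$, $\bar h_{k+1}=f(y_{k+1})-\langle\bar g_{k+1},y_{k+1}\rangle+\frac{\tau}{2}\|\bar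 g_{k+1}\|_*^2$, $\bar e_{k+1}=f(y_{k+1})-\frac{\tau}{2}\|\bar g_{k+1}\|_*^2$. 3. If $k=0$: $\bar H_1=\bar h_1$, $G_1=\bar g_1$, $\lambda_1=1$, $A_1=a_1$. If $k\ge1$: choose a model of some size $\tilde m\ge2$, consisting of $\bar H_{k+1}\in\mathbb{R}^{\tilde m}$ and $G_{k+1}$ with $\tilde m$ columns in $\mathbb{E}^*$, whose first entry/column is $(h_k,g_k)$, whose second entry/column is $(\bar h_{k+1},\bar g_{k+1})$, and such that every pair (entry of $\bar H_{k+1}$, corresponding column of $G_{k+1}$) is a convex combination, with common coefficients for entry and column, of the history pairs $(\bar h_j,\bar g_j)$, $j=1,\dots,k+1$. Let $Q_{k+1}=G_{k+1}^TB^{-1}G_{k+1}$, $S_{k+1}=\bar H_{k+1}+G_{k+1}^Tx_0$, $\lambda_{k+1}^{(0)}=\frac{1}{A_k+a_{k+1}}(A_k,a_{k+1},0,\dots,0)^T$, and $(\lambda_{k+1},A_{k+1})=\mathrm{Newton}(\tau,Q_{k+1},S_{k+1},\bar e_{k+1},\lambda_{k+1}^{(0)},A_k+a_{k+1})$. 4. $h_{k+1}=\langle\bar H_{k+1},\lambda_{k+1}\rangle$, $g_{k+1}=G_{k+1}\lambda_{k+1}$, $v_{k+1}=x_0-A_{k+1}B^{-1}g_{k+1}$. Procedure $\mathrm{Newton}(\tau,Q,S,\bar e,\lambda^{(0)},A^{(0)})$, with a fixed number $N$ of passes: set $\lambda_{\mathrm{valid}}=\lambda^{(0)}$, $A_{\mathrm{valid}}=A=A^{(0)}$.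 For $t=0,\dots,N-1$: let $\lambda=\lambda_{Q,S}(A+\tau)$ be an approximate solution of $\min_{\lambda\in\Delta_{\tilde m}}\left\{\frac{A+\tau}{2}\langle\lambda,Q\lambda\rangle-\langle S,\lambda\rangle\right\}$ returned by a subprocedure started at $\lambda^{(0)}$ whose only requirement is that it outputs a point of $\Delta_{\tilde m}$ with objective value no worse than at the starting point; let $\omega^*=\langle S,\lambda\rangle-\frac{A+\tau}{2}\langle\lambda,Q\lambda\rangle$; if $\omega^*<\bar e$, leave the loop; otherwise set $\lambda_{\mathrm{valid}}=\lambda$, $A_{\mathrm{valid}}=A$, and replace $A$ by $A+2\frac{\omega^*-\bar e}{\langle\lambda,Q\lambda\rangle}$ (if $\langle\lambda,Q\lambda\rangle=0$, leave the loop). Return $(\lambda_{\mathrm{valid}},A_{\mathrm{valid}})$. *)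

theory Defs
  imports "HOL-Analysis.Analysis"
begin

text \<open>
  The primal space is a type \<open>'a\<close> of class \<open>euclidean_space\<close> and its dual is
  \<open>'a \<Rightarrow>\<^sub>L real\<close>; the pairing of \<open>s\<close> and \<open>x\<close> is \<open>blinfun_apply s x\<close>.
  The inner product and norm carried by the type class only provide the (unique) vector space
  topology; all metric quantities below come from the operator \<open>B\<close>.
\<close>

definition spd_operator :: "('a::euclidean_space \<Rightarrow> ('a \<Rightarrow>\<^sub>L real)) \<Rightarrow> bool" where
  "spd_operator B \<longleftrightarrow> linear B
     \<and> (\<forall>x y. blinfun_apply (B x) y = blinfun_apply (B y) x)
     \<and> (\<forall>x. x \<noteq> 0 \<longrightarrow> 0 < blinfun_apply (B x) x)"

definition primal_norm :: "('a::euclidean_space \<Rightarrow> ('a \<Rightarrow>\<^sub>L real)) \<Rightarrow> 'a \<Rightarrow> real" where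
  "primal_norm B x = sqrt (blinfun_apply (B x) x)"

text \<open>A symmetric positive definite \<open>B\<close> is bijective, so \<open>inv B\<close> is its two-sided inverse.\<close>

definition dual_norm :: "('a::euclidean_space \<Rightarrow> ('a \<Rightarrow>\<^sub>L real)) \<Rightarrow> ('a \<Rightarrow>\<^sub>L real) \<Rightarrow> real" where
  "dual_norm B g = sqrt (blinfun_apply g (inv B g))"

definition minimizers :: "('a \<Rightarrow> real) \<Rightarrow> 'a set" where
  "minimizers f = {z. is_arg_min f (\<lambda>_. True) z}"

text \<open>
  The model size varies from iteration to iteration, so a vector of \<open>\<real>\<^sup>m\<close> is a function on \<open>nat\<close>
  of which the entries \<open>0, \<dots>, m - 1\<close> are relevant, and likewise for matrices.
\<close>

definition std_simplex :: "nat \<Rightarrow> (nat \<Rightarrow> real) set" where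
  "std_simplex m = {l. (\<forall>i<m. 0 \<le> l i) \<and> (\<forall>i\<ge>m. l i = 0) \<and> (\<Sum>i<m. l i) = 1}"

definition vdot :: "nat \<Rightarrow> (nat \<Rightarrow> real) \<Rightarrow> (nat \<Rightarrow> real) \<Rightarrow> real" where
  "vdot m u w = (\<Sum>i<m. u i * w i)"

definition mat_vec :: "nat \<Rightarrow> (nat \<Rightarrow> nat \<Rightarrow> real) \<Rightarrow> (nat \<Rightarrow> real) \<Rightarrow> nat \<Rightarrow> real" where
  "mat_vec m Q l i = (\<Sum>j<m. Q i j * l j)"

definition aux_objective ::
    "nat \<Rightarrow> (nat \<Rightarrow> nat \<Rightarrow> real) \<Rightarrow> (nat \<Rightarrow> real) \<Rightarrow> real \<Rightarrow> (nat \<Rightarrow> real) \<Rightarrow> real" where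
  "aux_objective m Q S c l = c / 2 * vdot m l (mat_vec m Q l) - vdot m S l"

text \<open>All admissible outputs of the inexact solver of the auxiliary problem, started at \<open>l0\<close>.\<close>

definition aux_outputs ::
    "nat \<Rightarrow> (nat \<Rightarrow> nat \<Rightarrow> real) \<Rightarrow> (nat \<Rightarrow> real) \<Rightarrow> real \<Rightarrow> (nat \<Rightarrow> real) \<Rightarrow> (nat \<Rightarrow> real) set" where
  "aux_outputs m Q S c l0 =
     {l \<in> std_simplex m. aux_objective m Q S c l \<le> aux_objective m Q S c l0}"

definition omega_star ::
    "nat \<Rightarrow> (nat \<Rightarrow> nat \<Rightarrow> real) \<Rightarrow> (nat \<Rightarrow> real) \<Rightarrow> real \<Rightarrow> (nat \<Rightarrow> real) \<Rightarrow> real" where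
  "omega_star m Q S c l = vdot m S l - c / 2 * vdot m l (mat_vec m Q l)"

text \<open>
  \<open>newton_loop m \<tau> Q S e l0 n lv Av A l' A'\<close>: with \<open>n\<close> passes left, last valid pair \<open>(lv, Av)\<close> and
  current value \<open>A\<close>, the loop can return \<open>(l', A')\<close>. It is a relation because the inexact solver
  may answer differently in every call.
\<close>

inductive newton_loop ::
    "nat \<Rightarrow> real \<Rightarrow> (nat \<Rightarrow> nat \<Rightarrow> real) \<Rightarrow> (nat \<Rightarrow> real) \<Rightarrow> real \<Rightarrow> (nat \<Rightarrow> real)
      \<Rightarrow> nat \<Rightarrow> (nat \<Rightarrow> real) \<Rightarrow> real \<Rightarrow> real \<Rightarrow> (nat \<Rightarrow> real) \<Rightarrow> real \<Rightarrow> bool"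
  for m :: nat and \<tau> :: real and Q :: "nat \<Rightarrow> nat \<Rightarrow> real" and S :: "nat \<Rightarrow> real"
    and e :: real and l0 :: "nat \<Rightarrow> real"
where
  exhausted: "newton_loop m \<tau> Q S e l0 0 lv Av A lv Av"
| break_invalid:
    "l \<in> aux_outputs m Q S (A + \<tau>) l0 \<Longrightarrow> omega_star m Q S (A + \<tau>) l < e
      \<Longrightarrow> newton_loop m \<tau> Q S e l0 (Suc n) lv Av A lv Av"
| break_zero:
    "l \<in> aux_outputs m Q S (A + \<tau>) l0 \<Longrightarrow> e \<le> omega_star m Q S (A + \<tau>) l
      \<Longrightarrow> vdot m l (mat_vec m Q l) = 0
      \<Longrightarrow> newton_loop m \<tau> Q S e l0 (Suc n) lv Av A l A"
| pass:
    "l \<in> aux_outputs m Q S (A + \<tau>) l0 \<Longrightarrow> e \<le> omega_star m Q S (A + \<tau>) l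
      \<Longrightarrow> vdot m l (mat_vec m Q l) \<noteq> 0
      \<Longrightarrow> newton_loop m \<tau> Q S e l0 n l A
            (A + 2 * (omega_star m Q S (A + \<tau>) l - e) / vdot m l (mat_vec m Q l)) l' A'
      \<Longrightarrow> newton_loop m \<tau> Q S e l0 (Suc n) lv Av A l' A'"

definition newton ::
    "nat \<Rightarrow> nat \<Rightarrow> real \<Rightarrow> (nat \<Rightarrow> nat \<Rightarrow> real) \<Rightarrow> (nat \<Rightarrow> real) \<Rightarrow> real \<Rightarrow> (nat \<Rightarrow> real) \<Rightarrow> real
      \<Rightarrow> (nat \<Rightarrow> real) \<Rightarrow> real \<Rightarrow> bool" where
  "newton N m \<tau> Q S e l0 A0 l' A' \<longleftrightarrow> newton_loop m \<tau> Q S e l0 N l0 A0 A0 l' A'"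

text \<open>
  The quantities of one infinite run, indexed by the iteration number. \<open>msize k\<close> is the size of the
  model used in iteration \<open>k\<close>, whose entries and columns \<open>Hmod k i\<close> and \<open>Gmod k i\<close>, \<open>i < msize k\<close>,
  are counted from \<open>0\<close>.
\<close>

record (overloaded) ('a::euclidean_space) ogmm_run =
  xpt :: "nat \<Rightarrow> 'a"
  ypt :: "nat \<Rightarrow> 'a"
  vpt :: "nat \<Rightarrow> 'a"
  acoef :: "nat \<Rightarrow> real"
  Acoef :: "nat \<Rightarrow> real"
  gbar :: "nat \<Rightarrow> ('a \<Rightarrow>\<^sub>L real)"
  hbar :: "nat \<Rightarrow> real"
  ebar :: "nat \<Rightarrow> real"
  msize :: "nat \<Rightarrow> nat"
  Hmod :: "nat \<Rightarrow> nat \<Rightarrow> real"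
  Gmod :: "nat \<Rightarrow> nat \<Rightarrow> ('a \<Rightarrow>\<^sub>L real)"
  lam :: "nat \<Rightarrow> nat \<Rightarrow> real"
  hagg :: "nat \<Rightarrow> real"
  gagg :: "nat \<Rightarrow> ('a \<Rightarrow>\<^sub>L real)"

definition ogmm_init :: "'a::euclidean_space \<Rightarrow> 'a ogmm_run \<Rightarrow> bool" where
  "ogmm_init x0 r \<longleftrightarrow> xpt r 0 = x0 \<and> vpt r 0 = x0 \<and> Acoef r 0 = 0"

definition ogmm_oracle_step ::
    "('a::euclidean_space \<Rightarrow> ('a \<Rightarrow>\<^sub>L real)) \<Rightarrow> ('a \<Rightarrow> real) \<Rightarrow> ('a \<Rightarrow> ('a \<Rightarrow>\<^sub>L real)) \<Rightarrow> real
      \<Rightarrow> 'a ogmm_run \<Rightarrow> nat \<Rightarrow> bool" where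
  "ogmm_oracle_step B f f' L r k \<longleftrightarrow> (let \<tau> = 1 / L in
     acoef r (k+1) = \<tau> / 2 * (1 + sqrt (1 + 8 * L * Acoef r k))
   \<and> ypt r (k+1) = (1 / (Acoef r k + acoef r (k+1))) *\<^sub>R
                      (Acoef r k *\<^sub>R xpt r k + acoef r (k+1) *\<^sub>R vpt r k)
   \<and> gbar r (k+1) = f' (ypt r (k+1))
   \<and> xpt r (k+1) = ypt r (k+1) - \<tau> *\<^sub>R inv B (gbar r (k+1))
   \<and> hbar r (k+1) = f (ypt r (k+1)) - blinfun_apply (gbar r (k+1)) (ypt r (k+1))
                      + \<tau> / 2 * (dual_norm B (gbar r (k+1)))\<^sup>2
   \<and> ebar r (k+1) = f (ypt r (k+1)) - \<tau> / 2 * (dual_norm B (gbar r (k+1)))\<^sup>2)"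

definition ogmm_first_model :: "'a::euclidean_space ogmm_run \<Rightarrow> bool" where
  "ogmm_first_model r \<longleftrightarrow>
     msize r 1 = 1 \<and> Hmod r 1 0 = hbar r 1 \<and> Gmod r 1 0 = gbar r 1
   \<and> lam r 1 = (\<lambda>i. if i = 0 then 1 else 0) \<and> Acoef r 1 = acoef r 1"

definition ogmm_model_ok :: "'a::euclidean_space ogmm_run \<Rightarrow> nat \<Rightarrow> bool" where
  "ogmm_model_ok r k \<longleftrightarrow>
     2 \<le> msize r (k+1)
   \<and> Hmod r (k+1) 0 = hagg r k \<and> Gmod r (k+1) 0 = gagg r k
   \<and> Hmod r (k+1) 1 = hbar r (k+1) \<and> Gmod r (k+1) 1 = gbar r (k+1)
   \<and> (\<forall>i<msize r (k+1). \<exists>c :: nat \<Rightarrow> real.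
        (\<forall>j\<in>{1..k+1}. 0 \<le> c j) \<and> (\<Sum>j=1..k+1. c j) = 1
      \<and> Hmod r (k+1) i = (\<Sum>j=1..k+1. c j * hbar r j)
      \<and> Gmod r (k+1) i = (\<Sum>j=1..k+1. c j *\<^sub>R gbar r j))"

definition ogmm_newton_step ::
    "('a::euclidean_space \<Rightarrow> ('a \<Rightarrow>\<^sub>L real)) \<Rightarrow> real \<Rightarrow> nat \<Rightarrow> 'a ogmm_run \<Rightarrow> nat \<Rightarrow> bool" where
  "ogmm_newton_step B L N r k \<longleftrightarrow> (let
       Q = (\<lambda>i j. blinfun_apply (Gmod r (k+1) i) (inv B (Gmod r (k+1) j)));
       S = (\<lambda>i. Hmod r (k+1) i + blinfun_apply (Gmod r (k+1) i) (xpt r 0));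
       A0 = Acoef r k + acoef r (k+1);
       l0 = (\<lambda>i. if i = 0 then Acoef r k / A0 else if i = 1 then acoef r (k+1) / A0 else 0)
     in newton N (msize r (k+1)) (1 / L) Q S (ebar r (k+1)) l0 A0 (lam r (k+1)) (Acoef r (k+1)))"

definition ogmm_aggregate ::
    "('a::euclidean_space \<Rightarrow> ('a \<Rightarrow>\<^sub>L real)) \<Rightarrow> 'a ogmm_run \<Rightarrow> nat \<Rightarrow> bool" where
  "ogmm_aggregate B r k \<longleftrightarrow>
     hagg r (k+1) = vdot (msize r (k+1)) (Hmod r (k+1)) (lam r (k+1))
   \<and> gagg r (k+1) = (\<Sum>i<msize r (k+1). lam r (k+1) i *\<^sub>R Gmod r (k+1) i)
   \<and> vpt r (k+1) = xpt r 0 - Acoef r (k+1) *\<^sub>R inv B (gagg r (k+1))"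

definition is_ogmm_run ::
    "('a::euclidean_space \<Rightarrow> ('a \<Rightarrow>\<^sub>L real)) \<Rightarrow> ('a \<Rightarrow> real) \<Rightarrow> ('a \<Rightarrow> ('a \<Rightarrow>\<^sub>L real)) \<Rightarrow> real \<Rightarrow> nat
      \<Rightarrow> 'a \<Rightarrow> 'a ogmm_run \<Rightarrow> bool" where
  "is_ogmm_run B f f' L N x0 r \<longleftrightarrow>
     ogmm_init x0 r
   \<and> (\<forall>k. ogmm_oracle_step B f f' L r k
        \<and> (if k = 0 then ogmm_first_model r
           else ogmm_model_ok r k \<and> ogmm_newton_step B L N r k)
        \<and> ogmm_aggregate B r k)"

end

theory Submission
  imports Defs
begin

text \<open>
  Put \<open>\<tau> = 1/L\<close>. The run preserves the certificate
  \<open>ebar\<^sub>k \<le> h\<^sub>k + \<langle>g\<^sub>k, x\<^sub>0\<rangle> - (A\<^sub>k + \<tau>)/2 \<parallel>g\<^sub>k\<parallel>\<^sub>*\<^sup>2\<close>, whose right-hand side is the minimum over \<open>x\<close> of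
  \<open>h\<^sub>k + \<langle>g\<^sub>k, x\<rangle> + \<parallel>x - x\<^sub>0\<parallel>\<^sup>2 / (2 (A\<^sub>k + \<tau>))\<close>. By the interpolation inequality of smooth convex
  functions, every model is a lower bound of the optimal value at a minimizer, and
  \<open>f(x\<^sub>k) \<le> ebar\<^sub>k\<close>; hence \<open>f(x\<^sub>k) - f\<^sup>* \<le> \<parallel>x\<^sub>0 - x\<^sup>*\<parallel>\<^sup>2 / (2 (A\<^sub>k + \<tau>))\<close>. The starting point
  \<open>\<lambda>\<^sup>(\<^sup>0\<^sup>)\<close> of Newton's procedure satisfies the certificate with \<open>A\<^sub>k + a\<^sub>k\<^sub>+\<^sub>1\<close>, with slack proportional
  to \<open>\<parallel>g\<^sub>k - gbar\<^sub>k\<^sub>+\<^sub>1\<parallel>\<^sub>*\<^sup>2\<close>, and each pass keeps it while only increasing \<open>A\<close>.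
\<close>

section \<open>Linear algebra of the metric given by \<open>B\<close>\<close>

locale spd =
  fixes B :: "'a::euclidean_space \<Rightarrow> ('a \<Rightarrow>\<^sub>L real)"
  assumes spd: "spd_operator B"
begin

abbreviation dual_inner :: "('a \<Rightarrow>\<^sub>L real) \<Rightarrow> ('a \<Rightarrow>\<^sub>L real) \<Rightarrow> real" where
  "dual_inner g h \<equiv> blinfun_apply g (inv B h)"

lemma linear_B: "linear B"
  and B_sym: "blinfun_apply (B x) y = blinfun_apply (B y) x"
  and B_pos: "x \<noteq> 0 \<Longrightarrow> 0 < blinfun_apply (B x) x"
  using spd unfolding spd_operator_def by blast+

lemma B_nonneg: "0 \<le> blinfun_apply (B x) x"
  using B_pos[of x] by (cases "x = 0") auto

text \<open>Positive definiteness makes the kernel trivial. Surjectivity comes from the coordinate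
  map \<open>T\<close>, an injective linear endomorphism of a finite-dimensional space.\<close>

lemma bij_B: "bij B"
proof -
  have kernel: "x = 0" if "B x = 0" for x
    using B_pos[of x] that by auto
  have inj: "inj B"
    using linear_injective_0[OF linear_B] kernel by blast
  define T where "T x = (\<Sum>b\<in>Basis. blinfun_apply (B x) b *\<^sub>R b)" for x
  have T_inner: "T x \<bullet> b = blinfun_apply (B x) b" if "b \<in> Basis" for x b
    using that by (simp add: T_def)
  have "linear T"
    unfolding T_def
    by (rule linearI) (simp_all add: linear_add[OF linear_B] linear_scale[OF linear_B]
        blinfun.bilinear_simps scaleR_add_left sum.distrib scaleR_sum_right)
  moreover have "inj T"
  proof (rule injI)
    fix x y assume "T x = T y"
    then have "B x = B y"
      by (intro blinfun_euclidean_eqI) (metis T_inner)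
    then show "x = y" using inj by (simp add: inj_eq)
  qed
  ultimately have "surj T" by (rule linear_inj_imp_surj)
  have "\<exists>x. g = B x" for g
  proof -
    obtain x where x: "T x = (\<Sum>b\<in>Basis. blinfun_apply g b *\<^sub>R b)"
      using \<open>surj T\<close> by (metis surjD)
    have "B x = g"
    proof (rule blinfun_euclidean_eqI)
      fix b :: 'a assume b: "b \<in> Basis"
      have "blinfun_apply (B x) b = T x \<bullet> b" using T_inner b by simp
      also have "\<dots> = blinfun_apply g b" using b by (simp add: x)
      finally show "blinfun_apply (B x) b = blinfun_apply g b" .
    qed
    then show ?thesis by blast
  qed
  then have "surj B" by (simp add: surj_def)
  with inj show ?thesis by (simp add: bij_def)
qed

lemma B_inv [simp]: "B (inv B g) = g"
  using bij_B by (simp add: bij_def surj_f_inv_f)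

lemma inv_B [simp]: "inv B (B x) = x"
  using bij_B by (simp add: bij_def)

lemma linear_inv_B: "linear (inv B)"
proof (rule linearI)
  show "inv B (g + h) = inv B g + inv B h" for g h
    by (metis B_inv inv_B linear_add[OF linear_B])
  show "inv B (c *\<^sub>R g) = c *\<^sub>R inv B g" for c g
    by (metis B_inv inv_B linear_scale[OF linear_B])
qed

lemma dual_inner_sym: "dual_inner g h = dual_inner h g"
  by (metis B_inv B_sym)

lemma dual_inner_nonneg: "0 \<le> dual_inner g g"
  using B_nonneg[of "inv B g"] by simp

lemma dual_norm_power2 [simp]: "(dual_norm B g)\<^sup>2 = dual_inner g g"
  by (simp add: dual_norm_def dual_inner_nonneg)

lemma primal_norm_power2 [simp]: "(primal_norm B x)\<^sup>2 = blinfun_apply (B x) x"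
  by (simp add: primal_norm_def B_nonneg)

lemmas dual_simps = blinfun.bilinear_simps linear_add[OF linear_inv_B]
  linear_diff[OF linear_inv_B] linear_scale[OF linear_inv_B]

lemma dual_inner_diff:
  "dual_inner (g - h) (g - h) = dual_inner g g - 2 * dual_inner g h + dual_inner h h"
  by (simp add: dual_simps dual_inner_sym[of h g])

text \<open>Fenchel-Young, from the nonnegative dual square of \<open>c *\<^sub>R g - B d\<close>.
  It carries out the minimization over the point in the certificate.\<close>

lemma pairing_le:
  assumes "c > 0"
  shows "blinfun_apply g d - c / 2 * dual_inner g g \<le> blinfun_apply (B d) d / (2 * c)"
proof -
  have "0 \<le> dual_inner (c *\<^sub>R g - B d) (c *\<^sub>R g - B d)" by (rule dual_inner_nonneg)
  also have "\<dots> = c * (c * dual_inner g g) - 2 * c * blinfun_apply g d + blinfun_apply (B d) d"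
    using dual_inner_sym[of "B d" g] by (simp add: dual_simps algebra_simps)
  finally show ?thesis using assms by (simp add: field_simps)
qed

text \<open>Cauchy-Schwarz for the duality pairing: expand the dual square of
  \<open>?q *\<^sub>R g - ?t *\<^sub>R B d\<close> and divide by \<open>?q\<close>.\<close>

lemma pairing_le_norms: "blinfun_apply g d \<le> dual_norm B g * primal_norm B d"
proof -
  let ?p = "dual_inner g g" and ?q = "blinfun_apply (B d) d" and ?t = "blinfun_apply g d"
  have "?t\<^sup>2 \<le> ?p * ?q"
  proof (cases "d = 0")
    case False
    then have q: "?q > 0" by (rule B_pos)
    have "0 \<le> dual_inner (?q *\<^sub>R g - ?t *\<^sub>R B d) (?q *\<^sub>R g - ?t *\<^sub>R B d)"
      by (rule dual_inner_nonneg)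
    also have "\<dots> = ?q * (?p * ?q - ?t\<^sup>2)"
      using dual_inner_sym[of "B d" g] by (simp add: dual_simps algebra_simps power2_eq_square)
    finally show ?thesis using q by (simp add: zero_le_mult_iff)
  qed simp
  then have "?t \<le> sqrt (?p * ?q)" by (rule real_le_rsqrt)
  then show ?thesis by (simp add: dual_norm_def primal_norm_def real_sqrt_mult)
qed

end

section \<open>Smooth convex functions\<close>

locale smooth_convex = spd B for B :: "'a::euclidean_space \<Rightarrow> ('a \<Rightarrow>\<^sub>L real)" +
  fixes f :: "'a \<Rightarrow> real" and f' :: "'a \<Rightarrow> ('a \<Rightarrow>\<^sub>L real)" and L :: real
  assumes convex: "convex_on UNIV f"
    and deriv: "(f has_derivative blinfun_apply (f' x)) (at x)"
    and L_pos: "L > 0"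
    and lipschitz: "dual_norm B (f' x - f' y) \<le> L * primal_norm B (x - y)"
begin

lemma line_deriv:
  "((\<lambda>t. f (x + t *\<^sub>R d)) has_real_derivative blinfun_apply (f' (x + t *\<^sub>R d)) d) (at t)"
proof -
  have "((\<lambda>t. f (x + t *\<^sub>R d)) has_derivative (\<lambda>s. blinfun_apply (f' (x + t *\<^sub>R d)) (s *\<^sub>R d))) (at t)"
    by (rule has_derivative_compose[OF _ deriv]) (auto intro!: derivative_eq_intros)
  then show ?thesis
    by (simp add: has_field_derivative_def blinfun.bilinear_simps mult_commute_abs)
qed

lemma tangent_below: "f x + blinfun_apply (f' x) (y - x) \<le> f y"
proof -
  have "convex_on UNIV (\<lambda>t. f (x + t *\<^sub>R (y - x)))" (is "convex_on _ ?\<phi>")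
  proof (rule convex_onI)
    fix t u w :: real assume "0 < t" "t < 1"
    have "x + ((1 - t) *\<^sub>R u + t *\<^sub>R w) *\<^sub>R (y - x)
        = (1 - t) *\<^sub>R (x + u *\<^sub>R (y - x)) + t *\<^sub>R (x + w *\<^sub>R (y - x))"
      by (simp add: algebra_simps)
    then show "f (x + ((1 - t) *\<^sub>R u + t *\<^sub>R w) *\<^sub>R (y - x))
        \<le> (1 - t) * f (x + u *\<^sub>R (y - x)) + t * f (x + w *\<^sub>R (y - x))"
      using convex_onD[OF convex, of t] \<open>0 < t\<close> \<open>t < 1\<close> by simp
  qed simp
  moreover have "(?\<phi> has_real_derivative blinfun_apply (f' x) (y - x)) (at 0)"
    using line_deriv[of x "y - x" 0] by simp
  ultimately have "blinfun_apply (f' x) (y - x) * (1 - 0) \<le> ?\<phi> 1 - ?\<phi> 0"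
    by (intro convex_on_imp_above_tangent[where A = UNIV]) auto
  then show ?thesis by simp
qed

text \<open>Monotonicity of \<open>\<phi>\<close> on the unit interval replaces integration: its
  derivative is nonpositive by Cauchy-Schwarz and the Lipschitz bound on the gradient.\<close>

lemma descent: "f (x + d) \<le> f x + blinfun_apply (f' x) d + L / 2 * blinfun_apply (B d) d"
proof -
  let ?q = "blinfun_apply (B d) d"
  define \<phi> where "\<phi> t = f (x + t *\<^sub>R d) - t * blinfun_apply (f' x) d - L / 2 * t\<^sup>2 * ?q" for t
  have "\<phi> 1 \<le> \<phi> 0"
  proof (rule DERIV_nonpos_imp_nonincreasing[where f = \<phi>])
    fix t :: real assume "0 \<le> t" "t \<le> 1"
    have \<phi>': "(\<phi> has_real_derivative
        blinfun_apply (f' (x + t *\<^sub>R d)) d - blinfun_apply (f' x) d - L * t * ?q) (at t)"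
      unfolding \<phi>_def by (auto intro!: derivative_eq_intros line_deriv)
    have "blinfun_apply (f' (x + t *\<^sub>R d) - f' x) d
        \<le> dual_norm B (f' (x + t *\<^sub>R d) - f' x) * primal_norm B d"
      by (rule pairing_le_norms)
    moreover have "\<dots> \<le> (L * primal_norm B (t *\<^sub>R d)) * primal_norm B d"
      using lipschitz[of "x + t *\<^sub>R d" x] B_nonneg[of d]
      by (intro mult_right_mono) (auto simp: primal_norm_def)
    moreover have "primal_norm B (t *\<^sub>R d) = t * primal_norm B d"
      using \<open>0 \<le> t\<close> unfolding primal_norm_def linear_scale[OF linear_B]
      by (simp add: blinfun.bilinear_simps real_sqrt_mult)
    moreover have "primal_norm B d * primal_norm B d = ?q"
      using primal_norm_power2[of d] by (simp add: power2_eq_square)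
    ultimately have "blinfun_apply (f' (x + t *\<^sub>R d)) d - blinfun_apply (f' x) d - L * t * ?q \<le> 0"
      by (simp add: blinfun.diff_left mult.assoc)
    with \<phi>' show "\<exists>y. (\<phi> has_real_derivative y) (at t) \<and> y \<le> 0" by blast
  qed simp
  then show ?thesis by (simp add: \<phi>_def)
qed

text \<open>Compare the tangent at \<open>y\<close> with \<open>f\<close> at the gradient step from \<open>x\<close> for
  \<open>f - \<langle>f' y, \<cdot>\<rangle>\<close>, which \<open>y\<close> minimizes.\<close>

lemma interpolation:
  "f y + blinfun_apply (f' y) (x - y) + 1 / L / 2 * dual_inner (f' x - f' y) (f' x - f' y) \<le> f x"
proof -
  let ?D = "f' x - f' y"
  define d where "d = - (1 / L) *\<^sub>R inv B ?D"
  have "L / 2 * blinfun_apply (B d) d = 1 / L / 2 * dual_inner ?D ?D"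
    using L_pos unfolding d_def linear_scale[OF linear_B]
    by (simp add: blinfun.scaleR_left blinfun.scaleR_right blinfun.minus_left blinfun.minus_right)
  moreover have "blinfun_apply ?D d = - (1 / L) * dual_inner ?D ?D"
    by (simp add: d_def blinfun.scaleR_right blinfun.minus_right)
  moreover have "f y + blinfun_apply (f' y) (x + d - y)
      \<le> f x + blinfun_apply (f' x) d + L / 2 * blinfun_apply (B d) d"
    using tangent_below[of y "x + d"] descent[of x d] by linarith
  ultimately show ?thesis
    unfolding blinfun.add_right blinfun.diff_left[of "f' x" "f' y" d] blinfun.diff_right by argo
qed

lemma gradient_step:
  "f (y - (1 / L) *\<^sub>R inv B (f' y)) \<le> f y - 1 / L / 2 * dual_inner (f' y) (f' y)"
  using descent[of y "- (1 / L) *\<^sub>R inv B (f' y)"] L_pos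
  unfolding linear_scale[OF linear_B]
  by (simp add: blinfun.scaleR_left blinfun.scaleR_right blinfun.minus_left blinfun.minus_right)

lemma gradient_minimizer:
  assumes "z \<in> minimizers f"
  shows "f' z = 0"
proof -
  have "f z \<le> f y" for y
    using assms by (auto simp: minimizers_def is_arg_min_def not_less)
  then have "blinfun_apply (f' z) = (\<lambda>v. 0)"
    by (intro has_derivative_local_min[OF deriv]) auto
  then show ?thesis by (intro blinfun_eqI) simp
qed

end

section \<open>The certificate under one averaging step and under Newton's procedure\<close>

text \<open>After clearing denominators, the slack is \<open>\<tau> \<alpha> a (p - 2 c + q) / (2 (\<alpha> + a)\<^sup>2)\<close>.\<close>

lemma certificate_step:
  fixes \<alpha> a \<tau> p q c s e F lx lv :: real
  assumes pos: "0 \<le> \<alpha>" "0 < a" "0 < \<tau>"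
    and root: "a\<^sup>2 = \<tau> * (2 * \<alpha> + a)"
    and psd: "0 \<le> p - 2 * c + q"
    and certificate: "e \<le> s - (\<alpha> + \<tau>) / 2 * p"
    and lower: "F + lx + \<tau> / 2 * q \<le> e"
    and balance: "\<alpha> * lx + a * lv = 0"
  shows "F - \<tau> / 2 * q \<le> (\<alpha> * s + a * (F + \<tau> / 2 * q + lv + \<alpha> * c)) / (\<alpha> + a)
    - (\<alpha> + a + \<tau>) / 2 * ((\<alpha>\<^sup>2 * p + 2 * \<alpha> * a * c + a\<^sup>2 * q) / (\<alpha> + a)\<^sup>2)"
proof -
  define A where "A = \<alpha> + a"
  have A: "A > 0" using pos by (simp add: A_def)
  define R where "R = (\<alpha> * s + a * (F + \<tau> / 2 * q + lv + \<alpha> * c)) * (2 * A)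
    - (A + \<tau>) * (\<alpha>\<^sup>2 * p + 2 * \<alpha> * a * c + a\<^sup>2 * q)"
  have s: "F + lx + \<tau> / 2 * q + (\<alpha> + \<tau>) / 2 * p \<le> s"
    using certificate lower by linarith
  have "\<alpha> * (F + lx + \<tau> / 2 * q + (\<alpha> + \<tau>) / 2 * p) * (2 * A) \<le> \<alpha> * s * (2 * A)"
    using s pos A by (intro mult_right_mono mult_left_mono) auto
  moreover have "\<alpha> * (F + lx + \<tau> / 2 * q + (\<alpha> + \<tau>) / 2 * p) * (2 * A)
      + a * (F + \<tau> / 2 * q + lv + \<alpha> * c) * (2 * A)
      - (A + \<tau>) * (\<alpha>\<^sup>2 * p + 2 * \<alpha> * a * c + a\<^sup>2 * q)
      - (F - \<tau> / 2 * q) * (2 * A\<^sup>2) = \<tau> * \<alpha> * a * (p - 2 * c + q)"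
  proof -
    have "a * lv = - (\<alpha> * lx)" using balance by simp
    then show ?thesis using root unfolding A_def by algebra
  qed
  moreover have "0 \<le> \<tau> * \<alpha> * a * (p - 2 * c + q)"
    using pos psd by simp
  ultimately have "(F - \<tau> / 2 * q) * (2 * A\<^sup>2) \<le> R"
    unfolding R_def distrib_right[of "\<alpha> * s"] by linarith
  then have "F - \<tau> / 2 * q \<le> R / (2 * A\<^sup>2)"
    using A by (simp add: pos_le_divide_eq)
  also have "R / (2 * A\<^sup>2) = (\<alpha> * s + a * (F + \<tau> / 2 * q + lv + \<alpha> * c)) / A
    - (A + \<tau>) / 2 * ((\<alpha>\<^sup>2 * p + 2 * \<alpha> * a * c + a\<^sup>2 * q) / A\<^sup>2)"
    using A unfolding R_def by (simp add: diff_divide_distrib power2_eq_square)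
  finally show ?thesis unfolding A_def .
qed

text \<open>Apart from the given start, only pairs that passed the test
  \<open>e \<le> omega_star\<close> are returned. The increment of \<open>A\<close> is a nonnegative
  number over a positive value of the quadratic form, so \<open>A\<close> never decreases.\<close>

lemma newton_loop_valid:
  assumes "newton_loop m \<tau> Q S e l0 n lv Av A l' A'"
    and "\<And>l. 0 \<le> vdot m l (mat_vec m Q l)"
    and "lv \<in> std_simplex m" "e \<le> omega_star m Q S (Av + \<tau>) lv" "Av \<le> A"
  shows "l' \<in> std_simplex m \<and> e \<le> omega_star m Q S (A' + \<tau>) l' \<and> Av \<le> A'"
  using assms
proof (induction rule: newton_loop.induct)
  case (pass l A n l' A' lv Av)
  have "0 \<le> 2 * (omega_star m Q S (A + \<tau>) l - e) / vdot m l (mat_vec m Q l)"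
    using pass.hyps(2) pass.prems(1)[of l] by simp
  with pass show ?case by (fastforce simp: aux_outputs_def)
qed (auto simp: aux_outputs_def)

context spd
begin

text \<open>\<open>Q\<close> is the Gram matrix of the columns, so its quadratic form is the dual
  square of the aggregated column and hence nonnegative.\<close>

lemma dual_inner_sum:
  "vdot m l (mat_vec m (\<lambda>i j. dual_inner (G i) (G j)) l)
    = dual_inner (\<Sum>i<m. l i *\<^sub>R G i) (\<Sum>i<m. l i *\<^sub>R G i)"
proof -
  have "mat_vec m (\<lambda>i j. dual_inner (G i) (G j)) l i = dual_inner (G i) (\<Sum>j<m. l j *\<^sub>R G j)" for i
    by (simp add: mat_vec_def linear_sum[OF linear_inv_B] linear_scale[OF linear_inv_B]
        blinfun.sum_right blinfun.scaleR_right mult.commute)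
  then show ?thesis by (simp add: vdot_def blinfun.sum_left blinfun.scaleR_left)
qed

text \<open>Turns the test in Newton's procedure into the certificate inequality for the aggregated
  pair.\<close>

lemma omega_star_model:
  "omega_star m (\<lambda>i j. dual_inner (G i) (G j)) (\<lambda>i. H i + blinfun_apply (G i) x) c l
    = vdot m H l + blinfun_apply (\<Sum>i<m. l i *\<^sub>R G i) x
      - c / 2 * dual_inner (\<Sum>i<m. l i *\<^sub>R G i) (\<Sum>i<m. l i *\<^sub>R G i)"
  unfolding omega_star_def dual_inner_sum
  by (simp add: vdot_def blinfun.sum_left blinfun.scaleR_left algebra_simps sum.distrib)

end

text \<open>Serves on two levels: columns as mixtures of history pairs, and the aggregate as a
  mixture of columns.\<close>

lemma convex_sum_affine_le:
  fixes H :: "'b \<Rightarrow> real" and G :: "'b \<Rightarrow> ('a::real_normed_vector \<Rightarrow>\<^sub>L real)"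
  assumes "\<forall>i\<in>I. 0 \<le> c i" "sum c I = 1" "\<And>i. i \<in> I \<Longrightarrow> H i + blinfun_apply (G i) z \<le> u"
  shows "(\<Sum>i\<in>I. c i * H i) + blinfun_apply (\<Sum>i\<in>I. c i *\<^sub>R G i) z \<le> u"
proof -
  have "(\<Sum>i\<in>I. c i * H i) + blinfun_apply (\<Sum>i\<in>I. c i *\<^sub>R G i) z
      = (\<Sum>i\<in>I. c i * (H i + blinfun_apply (G i) z))"
    by (simp add: blinfun.sum_left blinfun.scaleR_left sum.distrib distrib_left)
  also have "\<dots> \<le> (\<Sum>i\<in>I. c i * u)"
    using assms by (intro sum_mono mult_left_mono) auto
  also have "\<dots> = u" using assms(2) by (simp add: sum_distrib_right[symmetric])
  finally show ?thesis .
qed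

section \<open>The equations of a run\<close>

locale ogmm = smooth_convex B f f' L
  for B :: "'a::euclidean_space \<Rightarrow> ('a \<Rightarrow>\<^sub>L real)" and f f' L +
  fixes N :: nat and x0 :: 'a and r :: "'a ogmm_run"
  assumes run: "is_ogmm_run B f f' L N x0 r"
begin

lemma init: "xpt r 0 = x0" "vpt r 0 = x0" "Acoef r 0 = 0"
  using run by (auto simp: is_ogmm_run_def ogmm_init_def)

lemma step:
  "acoef r (Suc k) = 1 / L / 2 * (1 + sqrt (1 + 8 * L * Acoef r k))"
  "ypt r (Suc k) = (1 / (Acoef r k + acoef r (Suc k))) *\<^sub>R
      (Acoef r k *\<^sub>R xpt r k + acoef r (Suc k) *\<^sub>R vpt r k)"
  "gbar r (Suc k) = f' (ypt r (Suc k))"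
  "xpt r (Suc k) = ypt r (Suc k) - (1 / L) *\<^sub>R inv B (gbar r (Suc k))"
  "hbar r (Suc k) = f (ypt r (Suc k)) - blinfun_apply (gbar r (Suc k)) (ypt r (Suc k))
      + 1 / L / 2 * dual_inner (gbar r (Suc k)) (gbar r (Suc k))"
  "ebar r (Suc k) = f (ypt r (Suc k)) - 1 / L / 2 * dual_inner (gbar r (Suc k)) (gbar r (Suc k))"
  using run unfolding is_ogmm_run_def ogmm_oracle_step_def Let_def dual_norm_power2 Suc_eq_plus1
  by blast+

lemma first_model: "ogmm_first_model r"
  using run by (auto simp: is_ogmm_run_def)

lemma model:
  assumes "k \<ge> 1"
  shows "ogmm_model_ok r k" "ogmm_newton_step B L N r k"
  using run assms unfolding is_ogmm_run_def by (metis not_one_le_zero)+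

lemma aggregate:
  "hagg r (Suc k) = vdot (msize r (Suc k)) (Hmod r (Suc k)) (lam r (Suc k))"
  "gagg r (Suc k) = (\<Sum>i<msize r (Suc k). lam r (Suc k) i *\<^sub>R Gmod r (Suc k) i)"
  "vpt r (Suc k) = x0 - Acoef r (Suc k) *\<^sub>R inv B (gagg r (Suc k))"
  using run init by (simp_all add: is_ogmm_run_def ogmm_aggregate_def)

lemma first_step:
  "Acoef r 1 = 1 / L" "ypt r 1 = x0" "hagg r 1 = hbar r 1" "gagg r 1 = gbar r 1"
  using first_model step(1,2)[of 0] aggregate[of 0] init L_pos
  by (simp_all add: ogmm_first_model_def vdot_def)

lemma step_root:
  assumes "0 \<le> Acoef r k"
  shows "0 < acoef r (Suc k)" "(acoef r (Suc k))\<^sup>2 = 1 / L * (2 * Acoef r k + acoef r (Suc k))"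
proof -
  define w where "w = sqrt (1 + 8 * L * Acoef r k)"
  have w: "w\<^sup>2 = 1 + 8 * L * Acoef r k" "0 \<le> w"
    using assms L_pos by (simp_all add: w_def)
  have a: "acoef r (Suc k) = (1 + w) / (2 * L)"
    using step(1)[of k] by (simp add: w_def)
  show "0 < acoef r (Suc k)" using w L_pos by (simp add: a)
  \<comment> \<open>With \<open>a = (1 + w) / (2 L)\<close> this is \<open>L a^2 = 2 A + a\<close>
    multiplied by \<open>4 L\<close>.\<close>
  have "(1 + w)\<^sup>2 = 8 * L * Acoef r k + 2 * (1 + w)"
    using w by (simp add: power2_sum)
  then show "(acoef r (Suc k))\<^sup>2 = 1 / L * (2 * Acoef r k + acoef r (Suc k))"
    using L_pos by (simp add: a power_divide power2_eq_square field_simps)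
qed

section \<open>The certificate along the run and the growth of \<open>Acoef\<close>\<close>

definition certified :: "nat \<Rightarrow> bool" where
  "certified k \<longleftrightarrow> ebar r k \<le> hagg r k + blinfun_apply (gagg r k) x0
      - (Acoef r k + 1 / L) / 2 * dual_inner (gagg r k) (gagg r k)"

text \<open>Equality holds: \<open>ypt r 1 = x0\<close> makes the pairings cancel, and
  \<open>Acoef r 1 + 1 / L = 2 / L\<close> turns the coefficient \<open>1 / (2 L)\<close> of the
  dual square into its negative.\<close>

lemma certified_1: "certified 1"
  using step(3,5,6)[of 0] first_step
  by (simp add: certified_def field_simps)

text \<open>Convexity and smoothness of \<open>f\<close> enter only through \<open>lower\<close>;
  the rest is the algebra of \<open>certificate_step\<close>.\<close>

lemma initial_weights_certified:
  assumes k: "k \<ge> 1" and A: "0 \<le> Acoef r k" and cert: "certified k"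
  defines "A0 \<equiv> Acoef r k + acoef r (Suc k)"
  defines "g \<equiv> (Acoef r k / A0) *\<^sub>R gagg r k + (acoef r (Suc k) / A0) *\<^sub>R gbar r (Suc k)"
  shows "ebar r (Suc k) \<le> (Acoef r k / A0) * hagg r k + (acoef r (Suc k) / A0) * hbar r (Suc k)
      + blinfun_apply g x0 - (A0 + 1 / L) / 2 * dual_inner g g"
proof -
  obtain j where j: "k = Suc j" using k by (cases k) auto
  let ?\<alpha> = "Acoef r k" and ?a = "acoef r (Suc k)"
  let ?g = "gagg r k" and ?h = "gbar r (Suc k)" and ?gj = "gbar r k"
  let ?y = "ypt r (Suc k)"
  define lx where "lx = blinfun_apply ?h (xpt r k - ?y)"
  define lv where "lv = blinfun_apply ?h (vpt r k - ?y)"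
  have a: "0 < ?a" "?a\<^sup>2 = 1 / L * (2 * ?\<alpha> + ?a)" using step_root[OF A] by auto
  have A0: "A0 > 0" using A a by (simp add: A0_def)
  \<comment> \<open>The query point is the weighted mean of \<open>xpt r k\<close> and
    \<open>vpt r k\<close>, so the weighted displacements from it cancel.\<close>
  have "A0 *\<^sub>R ?y = ?\<alpha> *\<^sub>R xpt r k + ?a *\<^sub>R vpt r k"
    using A0 step(2)[of k] by (simp add: A0_def)
  then have "A0 * blinfun_apply ?h ?y
      = ?\<alpha> * blinfun_apply ?h (xpt r k) + ?a * blinfun_apply ?h (vpt r k)"
    by (metis blinfun.add_right blinfun.scaleR_right real_scaleR_def)
  then have balance: "?\<alpha> * lx + ?a * lv = 0"
    by (simp add: lx_def lv_def A0_def blinfun.diff_right algebra_simps)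
  \<comment> \<open>Interpolation between consecutive query points. Passing from
    \<open>ypt r k\<close> to \<open>xpt r k\<close> cancels the cross term
    \<open>dual_inner ?gj ?h\<close>, and the dual square of \<open>?gj\<close> turns
    \<open>f (ypt r k)\<close> into \<open>ebar r k\<close>.\<close>
  have "f ?y + blinfun_apply ?h (ypt r k - ?y) + 1 / L / 2 * dual_inner (?gj - ?h) (?gj - ?h)
      \<le> f (ypt r k)"
    using interpolation[of ?y "ypt r k"] step(3)[of k] step(3)[of j] by (simp add: j)
  moreover have "lx = blinfun_apply ?h (ypt r k - ?y) - 1 / L * dual_inner ?gj ?h"
    using step(4)[of j] dual_inner_sym[of ?h ?gj]
    by (simp add: lx_def j blinfun.diff_right blinfun.scaleR_right)
  moreover have "ebar r k = f (ypt r k) - 1 / L / 2 * dual_inner ?gj ?gj"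
    using step(6)[of j] by (simp add: j)
  ultimately have lower: "f ?y + lx + 1 / L / 2 * dual_inner ?h ?h \<le> ebar r k"
    using L_pos unfolding dual_inner_diff by (simp add: field_simps)
  \<comment> \<open>Expressing \<open>x0\<close> through \<open>vpt r k\<close> produces the cross
    term \<open>?\<alpha> * dual_inner ?g ?h\<close>.\<close>
  have x0: "x0 = vpt r k + ?\<alpha> *\<^sub>R inv B ?g"
    using aggregate(3)[of j] by (simp add: j)
  have "blinfun_apply ?h x0 = lv + blinfun_apply ?h ?y + ?\<alpha> * dual_inner ?g ?h"
    using dual_inner_sym[of ?h ?g]
    by (subst x0) (simp add: lv_def blinfun.diff_right blinfun.add_right blinfun.scaleR_right)
  then have hbar: "hbar r (Suc k) + blinfun_apply ?h x0
      = f ?y + 1 / L / 2 * dual_inner ?h ?h + lv + ?\<alpha> * dual_inner ?g ?h"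
    using step(5)[of k] by simp
  have psd: "0 \<le> dual_inner ?g ?g - 2 * dual_inner ?g ?h + dual_inner ?h ?h"
    using dual_inner_nonneg[of "?g - ?h"] by (simp only: dual_inner_diff)
  have gg: "dual_inner g g = (?\<alpha>\<^sup>2 * dual_inner ?g ?g + 2 * ?\<alpha> * ?a * dual_inner ?g ?h
      + ?a\<^sup>2 * dual_inner ?h ?h) / A0\<^sup>2"
    using A0 dual_inner_sym[of ?h ?g]
    by (simp add: g_def dual_simps field_simps power2_eq_square)
  have hg: "(?\<alpha> / A0) * hagg r k + (?a / A0) * hbar r (Suc k) + blinfun_apply g x0
      = (?\<alpha> * (hagg r k + blinfun_apply ?g x0) + ?a * (hbar r (Suc k) + blinfun_apply ?h x0)) / A0"
    by (simp add: g_def blinfun.add_left blinfun.scaleR_left add_divide_distrib distrib_left)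
  \<comment> \<open>In \<open>certificate_step\<close>, \<open>p\<close>, \<open>c\<close> and
    \<open>q\<close> become the dual products of \<open>?g\<close> and \<open>?h\<close>,
    \<open>F\<close> is \<open>f ?y\<close>, and \<open>s\<close> is the old aggregate evaluated at
    \<open>x0\<close>.\<close>
  have "f ?y - 1 / L / 2 * dual_inner ?h ?h
      \<le> (?\<alpha> * (hagg r k + blinfun_apply ?g x0) + ?a * (hbar r (Suc k) + blinfun_apply ?h x0)) / A0
      - (A0 + 1 / L) / 2 * ((?\<alpha>\<^sup>2 * dual_inner ?g ?g + 2 * ?\<alpha> * ?a * dual_inner ?g ?h
          + ?a\<^sup>2 * dual_inner ?h ?h) / A0\<^sup>2)"
    unfolding hbar unfolding A0_def
    using A a L_pos psd lower balance cert[unfolded certified_def]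
    by (intro certificate_step[where e = "ebar r k" and lx = lx]) auto
  then show ?thesis using step(6)[of k] by (simp only: hg gg)
qed

lemma newton_step_certified:
  assumes k: "k \<ge> 1" and A: "0 \<le> Acoef r k" and cert: "certified k"
  shows "lam r (Suc k) \<in> std_simplex (msize r (Suc k))
    \<and> certified (Suc k) \<and> Acoef r k + acoef r (Suc k) \<le> Acoef r (Suc k)"
proof -
  let ?m = "msize r (Suc k)" and ?G = "Gmod r (Suc k)" and ?H = "Hmod r (Suc k)"
  let ?Q = "\<lambda>i j. dual_inner (?G i) (?G j)"
  let ?S = "\<lambda>i. ?H i + blinfun_apply (?G i) x0"
  define A0 where "A0 = Acoef r k + acoef r (Suc k)"
  define l0 where "l0 = (\<lambda>i::nat. if i = 0 then Acoef r k / A0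
    else if i = 1 then acoef r (Suc k) / A0 else 0)"
  note ok = model(1)[OF k, unfolded ogmm_model_ok_def]
  have m: "2 \<le> ?m" using ok by simp
  have a: "0 < acoef r (Suc k)" by (rule step_root(1)[OF A])
  have A0: "A0 > 0" using A a by (simp add: A0_def)
  \<comment> \<open>The starting weights vanish beyond the first two entries, which every model
    fixes as the old aggregate and the new pair; so the start is the same for every model
    size.\<close>
  have sum01: "(\<Sum>i<?m. F i) = F 0 + F 1" if "\<And>i. i \<ge> 2 \<Longrightarrow> F i = 0"
    for F :: "nat \<Rightarrow> 'c::comm_monoid_add"
  proof -
    have "(\<Sum>i<?m. F i) = (\<Sum>i<2. F i)"
      using m that by (intro sum.mono_neutral_right) auto
    then show ?thesis by (simp add: numeral_2_eq_2)
  qed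
  have "(\<Sum>i<?m. l0 i) = l0 0 + l0 1" by (rule sum01) (simp add: l0_def)
  also have "\<dots> = 1" using A0 by (simp add: l0_def A0_def add_divide_distrib[symmetric])
  finally have simplex: "l0 \<in> std_simplex ?m"
    using A a A0 m by (auto simp: std_simplex_def l0_def)
  have G: "(\<Sum>i<?m. l0 i *\<^sub>R ?G i)
      = (Acoef r k / A0) *\<^sub>R gagg r k + (acoef r (Suc k) / A0) *\<^sub>R gbar r (Suc k)"
    using ok by (subst sum01) (simp_all add: l0_def)
  have H: "vdot ?m ?H l0 = (Acoef r k / A0) * hagg r k + (acoef r (Suc k) / A0) * hbar r (Suc k)"
    using ok unfolding vdot_def by (subst sum01) (simp_all add: l0_def mult.commute)
  have "newton N ?m (1 / L) ?Q ?S (ebar r (Suc k)) l0 A0 (lam r (Suc k)) (Acoef r (Suc k))"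
    using model(2)[OF k] init(1)
    unfolding ogmm_newton_step_def Let_def l0_def A0_def Suc_eq_plus1 by simp
  then have loop: "newton_loop ?m (1 / L) ?Q ?S (ebar r (Suc k)) l0 N l0 A0 A0
      (lam r (Suc k)) (Acoef r (Suc k))"
    by (simp add: newton_def)
  have start: "ebar r (Suc k) \<le> omega_star ?m ?Q ?S (A0 + 1 / L) l0"
    using initial_weights_certified[OF k A cert]
    unfolding omega_star_model G H A0_def by simp
  have "lam r (Suc k) \<in> std_simplex ?m
    \<and> ebar r (Suc k) \<le> omega_star ?m ?Q ?S (Acoef r (Suc k) + 1 / L) (lam r (Suc k))
    \<and> A0 \<le> Acoef r (Suc k)"
    by (rule newton_loop_valid[OF loop _ simplex start order_refl])
      (simp add: dual_inner_sum dual_inner_nonneg)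
  then show ?thesis
    by (simp add: omega_star_model certified_def aggregate A0_def)
qed

text \<open>The exact growth \<open>A = k (k + 1) / (2 L)\<close> is attained when Newton's procedure never
  increases \<open>A\<close>; then \<open>1 + 8 L A = (2 k + 1)\<^sup>2\<close>.\<close>

lemma certified_growth:
  "certified (Suc k) \<and> real (Suc k) * (real (Suc k) + 1) / (2 * L) \<le> Acoef r (Suc k)"
proof (induction k)
  case 0
  show ?case using certified_1 first_step(1) L_pos by simp
next
  case (Suc k)
  let ?n = "real (Suc k)" and ?A = "Acoef r (Suc k)"
  have growth: "?n * (?n + 1) / (2 * L) \<le> ?A" and "certified (Suc k)"
    using Suc.IH by auto
  moreover have "0 \<le> ?n * (?n + 1) / (2 * L)" using L_pos by simp
  ultimately have step': "certified (Suc (Suc k))"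
      "?A + acoef r (Suc (Suc k)) \<le> Acoef r (Suc (Suc k))"
    using newton_step_certified[of "Suc k"] by auto
  have "?n * (?n + 1) \<le> ?A * (2 * L)"
    using growth L_pos by (subst (asm) pos_divide_le_eq) simp_all
  then have "4 * (?n * (?n + 1)) \<le> 8 * L * ?A" by argo
  then have "(2 * ?n + 1)\<^sup>2 \<le> 1 + 8 * L * ?A"
    by (simp add: power2_eq_square algebra_simps)
  then have "2 * ?n + 1 \<le> sqrt (1 + 8 * L * ?A)" by (rule real_le_rsqrt)
  then have "1 / L / 2 * (1 + (2 * ?n + 1)) \<le> acoef r (Suc (Suc k))"
    using L_pos unfolding step(1)[of "Suc k"] by (intro mult_left_mono) auto
  moreover have "real (Suc (Suc k)) * (real (Suc (Suc k)) + 1) / (2 * L)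
      = ?n * (?n + 1) / (2 * L) + 1 / L / 2 * (1 + (2 * ?n + 1))"
    using L_pos by (simp add: field_simps)
  ultimately show ?case using step' growth by linarith
qed

section \<open>Lower bounds at a minimizer and the convergence rate\<close>

text \<open>As the gradient at \<open>z\<close> is zero, interpolation retains the whole dual square
  of \<open>gbar\<close> that \<open>hbar\<close> contains. The bound is specific to minimizers:
  these affine functions need not lie below \<open>f\<close> elsewhere.\<close>

lemma history_lower_bound:
  assumes "z \<in> minimizers f"
  shows "hbar r (Suc j) + blinfun_apply (gbar r (Suc j)) z \<le> f z"
  using interpolation[of "ypt r (Suc j)" z] gradient_minimizer[OF assms] step(3,5)[of j]
  by (simp add: dual_simps linear_neg[OF linear_inv_B])

lemma aggregate_lower_bound:
  assumes z: "z \<in> minimizers f"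
  shows "hagg r (Suc k) + blinfun_apply (gagg r (Suc k)) z \<le> f z"
proof (cases k)
  case 0
  then show ?thesis using history_lower_bound[OF z, of 0] first_step by simp
next
  case (Suc n)
  let ?m = "msize r (Suc k)"
  have ok: "ogmm_model_ok r k" using model(1)[of k] Suc by simp
  have columns: "Hmod r (Suc k) i + blinfun_apply (Gmod r (Suc k) i) z \<le> f z" if i: "i < ?m" for i
  proof -
    obtain c where c: "\<forall>j\<in>{1..k+1}. 0 \<le> c j" "(\<Sum>j=1..k+1. c j) = 1"
        "Hmod r (k+1) i = (\<Sum>j=1..k+1. c j * hbar r j)"
        "Gmod r (k+1) i = (\<Sum>j=1..k+1. c j *\<^sub>R gbar r j)"
      using ok i unfolding ogmm_model_ok_def Suc_eq_plus1
      by (elim conjE allE[where x = i] impE exE) (assumption, rule that)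
    have "hbar r j + blinfun_apply (gbar r j) z \<le> f z" if "j \<in> {1..k+1}" for j
      using history_lower_bound[OF z, of "j - 1"] that by simp
    from convex_sum_affine_le[OF c(1,2) this] c(3,4) show ?thesis by simp
  qed
  \<comment> \<open>Nonnegativity puts the starting weights of Newton's procedure in the simplex,
    and with them whatever it returns.\<close>
  have "0 \<le> Acoef r k"
    using certified_growth[of n] L_pos Suc by (auto intro: order_trans[rotated])
  then have "lam r (Suc k) \<in> std_simplex ?m"
    using newton_step_certified[of k] certified_growth[of n] Suc by auto
  then have "(\<Sum>i<?m. lam r (Suc k) i * Hmod r (Suc k) i)
      + blinfun_apply (\<Sum>i<?m. lam r (Suc k) i *\<^sub>R Gmod r (Suc k) i) z \<le> f z"
    using columns by (intro convex_sum_affine_le) (auto simp: std_simplex_def)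
  then show ?thesis by (simp add: aggregate vdot_def mult.commute)
qed

lemma rate:
  assumes z: "z \<in> minimizers f"
  shows "f (xpt r (Suc k)) - f z
    \<le> L * (primal_norm B (x0 - z))\<^sup>2 / (real (Suc k) * (real (Suc k) + 1))"
proof -
  let ?g = "gagg r (Suc k)" and ?A = "Acoef r (Suc k)"
  let ?R = "blinfun_apply (B (x0 - z)) (x0 - z)"
  define n where "n = real (Suc k) * (real (Suc k) + 1)"
  have n: "n > 0" by (simp add: n_def)
  have growth: "n / (2 * L) \<le> ?A" using certified_growth[of k] by (simp add: n_def)
  moreover have "n / (2 * L) > 0" using n L_pos by simp
  ultimately have A: "?A > 0" "?A + 1 / L > 0" using L_pos by (auto intro: add_pos_pos)
  have "f (xpt r (Suc k)) \<le> ebar r (Suc k)"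
    using gradient_step[of "ypt r (Suc k)"] step(3,4,6)[of k] by simp
  also have "\<dots> \<le> hagg r (Suc k) + blinfun_apply ?g x0 - (?A + 1 / L) / 2 * dual_inner ?g ?g"
    using certified_growth[of k] by (simp add: certified_def)
  also have "\<dots> \<le> f z + blinfun_apply ?g (x0 - z) - (?A + 1 / L) / 2 * dual_inner ?g ?g"
    using aggregate_lower_bound[OF z, of k] by (simp add: blinfun.diff_right)
  also have "\<dots> \<le> f z + ?R / (2 * (?A + 1 / L))"
    using pairing_le[OF A(2), of ?g "x0 - z"] by linarith
  also have "\<dots> \<le> f z + ?R / (n / L)"
  proof -
    \<comment> \<open>The growth bound even gives \<open>(n + 2) / L\<close> on the left; weakening
      it to \<open>n / L\<close> yields the stated rate.\<close>
    have "n / L \<le> 2 * (?A + 1 / L)" using growth L_pos by (simp add: field_simps)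
    moreover have "0 < n / L" using n L_pos by simp
    ultimately show ?thesis
      using B_nonneg[of "x0 - z"] by (intro add_left_mono divide_left_mono mult_pos_pos) auto
  qed
  finally show ?thesis by (simp add: n_def mult.commute)
qed

end

theorem mainTheorem13:
  fixes B :: "'a::euclidean_space \<Rightarrow> ('a \<Rightarrow>\<^sub>L real)"
    and f :: "'a \<Rightarrow> real"
    and f' :: "'a \<Rightarrow> ('a \<Rightarrow>\<^sub>L real)"
    and Lf L :: real
    and N :: nat
    and x0 :: 'a
    and r :: "'a ogmm_run"
  assumes "spd_operator B"
    and "convex_on UNIV f"
    and "\<forall>x. (f has_derivative blinfun_apply (f' x)) (at x)"
    and "Lf > 0"
    and "\<forall>x y. dual_norm B (f' x - f' y) \<le> Lf * primal_norm B (x - y)"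
    and "minimizers f \<noteq> {}"
    and "L \<ge> Lf"
    and "is_ogmm_run B f f' L N x0 r"
  shows "\<forall>xstar\<in>minimizers f. \<forall>k\<ge>1.
           f (xpt r k) - f xstar \<le> L * (primal_norm B (x0 - xstar))\<^sup>2 / (real k * (real k + 1))"
proof (intro ballI allI impI)
  fix xstar and k :: nat
  assume xstar: "xstar \<in> minimizers f" and k: "1 \<le> k"
  \<comment> \<open>The locales carry the single constant \<open>L\<close>, so the Lipschitz bound
    is first relaxed from \<open>Lf\<close> to \<open>L\<close>.\<close>
  have "dual_norm B (f' x - f' y) \<le> L * primal_norm B (x - y)" for x y
  proof -
    interpret spd B using assms(1) by unfold_locales
    have "Lf * primal_norm B (x - y) \<le> L * primal_norm B (x - y)"
      using assms(7) B_nonneg[of "x - y"] by (intro mult_right_mono) (auto simp: primal_norm_def)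
    then show ?thesis using assms(5) by (meson order_trans)
  qed
  then interpret ogmm B f f' L N x0 r
    using assms by unfold_locales auto
  from rate[OF xstar, of "k - 1"] k
  show "f (xpt r k) - f xstar \<le> L * (primal_norm B (x0 - xstar))\<^sup>2 / (real k * (real k + 1))"
    by simp
qed

end
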